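(* Let $K$ be a field and $S=K[x_1,\ldots,x_n]$. Let $J_1,J_2,J_3,J_4\subset[n]$ be such that (1) $J_1\cap J_3=J_1\cap J_4=J_2\cap J_4=\emptyset$, and (2) $J_2\subseteq J_1\cup J_3$ and $J_3\subseteq J_2\cup J_4$. Then for any positive integer $a$, the ideal $$I=\mathfrak{m}_{J_1}^{a}\cap \mathfrak{m}_{J_2}^{a}\cap \mathfrak{m}_{J_3}^{a}\cap \mathfrak{m}_{J_4}^{a}\subset S$$ satisfies the non-pure dual exchange property.
   Context: $[n]=\{1,\ldots,n\}$. For $J\subseteq[n]$, $\mathfrak{m}_J$ denotes the ideal of $S$ generated by the variables $x_i$ with $i\in J$. For a monomial ideal $I\subset S$, $G(I)$ denotes its unique minimal set of monomial generators. For a monomial $u$, $\deg_{x_i}(u)$ denotes the exponent of $x_i$ in $u$, and $\deg(u)$ its total degree. Non-pure dual exchange property: a monomial ideal $I$ satisfies the non-pure dual exchange property if, for all $u,v\in G(I)$ with $\deg(u)\leq \deg(v)$ and for all $i$ such that $\deg_{x_i}(v)<\deg_{x_i}(u)$, there exists $j$ such that $\deg_{x_j}(v)>\deg_{x_j}(u)$ and $x_i(v/x_j)\in I$. *)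

theory Defs
  imports Complex_Main "HOL-Library.Poly_Mapping"
begin

text \<open>
  The polynomial ring \<open>K[x\<^sub>1,\<dots>,x\<^sub>n]\<close> is the monoid algebra of the exponent vectors
  \<^typ>\<open>'n \<Rightarrow>\<^sub>0 nat\<close>, where the finite type \<^typ>\<open>'n\<close> plays the role of \<open>[n]\<close>
  and \<open>n = CARD('n)\<close>.
\<close>

type_synonym 'n exponent = "'n \<Rightarrow>\<^sub>0 nat"
type_synonym ('n, 'k) mpoly = "'n exponent \<Rightarrow>\<^sub>0 'k"

definition monom :: "'n exponent \<Rightarrow> ('n, 'k::field) mpoly" where
  "monom u = Poly_Mapping.single u 1"

definition var :: "'n \<Rightarrow> ('n, 'k::field) mpoly" where
  "var i = monom (Poly_Mapping.single i 1)"

definition deg_in :: "'n \<Rightarrow> 'n exponent \<Rightarrow> nat" where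
  "deg_in i u = Poly_Mapping.lookup u i"

definition deg :: "'n::finite exponent \<Rightarrow> nat" where
  "deg u = (\<Sum>i\<in>UNIV. deg_in i u)"

text \<open>
  A commutative ring is a module over itself; its submodules are the ideals, so that
  \<open>ideal.subspace\<close> is the predicate of being an ideal and \<open>ideal.span\<close> is the ideal generated
  by a set.
\<close>

interpretation ideal: module "(*) :: 'a::comm_ring_1 \<Rightarrow> 'a \<Rightarrow> 'a"
  by standard (simp_all add: algebra_simps)

definition ideal_mult :: "'a::comm_ring_1 set \<Rightarrow> 'a set \<Rightarrow> 'a set" where
  "ideal_mult I J = ideal.span {p * q | p q. p \<in> I \<and> q \<in> J}"

primrec ideal_power :: "'a::comm_ring_1 set \<Rightarrow> nat \<Rightarrow> 'a set" where
  "ideal_power I 0 = UNIV"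
| "ideal_power I (Suc a) = ideal_mult I (ideal_power I a)"

definition var_ideal :: "'n set \<Rightarrow> ('n, 'k::field) mpoly set" where
  "var_ideal J = ideal.span (var ` J)"

definition monomial_ideal :: "('n, 'k::field) mpoly set \<Rightarrow> bool" where
  "monomial_ideal I \<longleftrightarrow> (\<exists>A. I = ideal.span (monom ` A))"

definition minimal_monomial_generators ::
    "('n, 'k::field) mpoly set \<Rightarrow> 'n exponent set \<Rightarrow> bool" where
  "minimal_monomial_generators I A \<longleftrightarrow>
     ideal.span (monom ` A) = I \<and> (\<forall>B. B \<subset> A \<longrightarrow> ideal.span (monom ` B) \<noteq> I)"

text \<open>
  \<open>G(I)\<close>, each monomial being given by its exponent vector. The description is justified by
  lemma \<open>ex1_minimal_monomial_generators\<close> below.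
\<close>

definition G :: "('n, 'k::field) mpoly set \<Rightarrow> 'n exponent set" where
  "G I = (THE A. minimal_monomial_generators I A)"

text \<open>
  The exponent vector \<open>v - single j 1 + single i 1\<close> is that of \<open>x\<^sub>i (v / x\<^sub>j)\<close>: the preceding
  condition forces \<open>deg_in j v > 0\<close>, so the subtraction is not truncated.
\<close>

definition nonpure_dual_exchange :: "('n::finite, 'k::field) mpoly set \<Rightarrow> bool" where
  "nonpure_dual_exchange I \<longleftrightarrow> monomial_ideal I \<and>
     (\<forall>u\<in>G I. \<forall>v\<in>G I. deg u \<le> deg v \<longrightarrow>
        (\<forall>i. deg_in i v < deg_in i u \<longrightarrow>
           (\<exists>j. deg_in j v > deg_in j u \<and>
                monom (v - Poly_Mapping.single j 1 + Poly_Mapping.single i 1) \<in> I)))"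


lemma monom_add: "(monom (u + v) :: ('n, 'k::field) mpoly) = monom u * monom v"
  by (simp add: monom_def mult_single)

lemma monom_in_span_iff:
  "(monom u :: ('n, 'k::field) mpoly) \<in> ideal.span (monom ` A) \<longleftrightarrow> (\<exists>a\<in>A. \<exists>w. u = a + w)"
proof
  let ?T = "{p :: ('n, 'k) mpoly. \<forall>k\<in>Poly_Mapping.keys p. \<exists>a\<in>A. \<exists>w. k = a + w}"
  assume "(monom u :: ('n, 'k) mpoly) \<in> ideal.span (monom ` A)"
  moreover have "ideal.span (monom ` A) \<subseteq> ?T"
  proof (rule ideal.span_minimal)
    show "(monom ` A :: ('n, 'k) mpoly set) \<subseteq> ?T"
    proof (clarsimp simp: monom_def)
      fix x assume "x \<in> A"
      moreover have "x = x + 0" by simp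
      ultimately show "\<exists>a\<in>A. \<exists>w. x = a + w" by blast
    qed
    show "ideal.subspace ?T"
    proof (rule ideal.subspaceI)
      fix p q :: "('n, 'k) mpoly" assume "p \<in> ?T" "q \<in> ?T"
      then show "p + q \<in> ?T" using Poly_Mapping.keys_add[of p q] by blast
    next
      fix c p :: "('n, 'k) mpoly" assume p: "p \<in> ?T"
      show "c * p \<in> ?T"
      proof (intro CollectI ballI)
        fix k assume "k \<in> Poly_Mapping.keys (c * p)"
        then obtain x y where "k = x + y" "y \<in> Poly_Mapping.keys p"
          using keys_mult[of c p] by blast
        with p obtain a w where "a \<in> A" "k = x + (a + w)" by auto
        then show "\<exists>a\<in>A. \<exists>w. k = a + w" by (metis add.left_commute)
      qed
    qed simp
  qed
  ultimately show "\<exists>a\<in>A. \<exists>w. u = a + w" by (auto simp: monom_def)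
next
  assume "\<exists>a\<in>A. \<exists>w. u = a + w"
  then obtain a w where "a \<in> A" and u: "u = w + a" by (metis add.commute)
  then show "(monom u :: ('n, 'k) mpoly) \<in> ideal.span (monom ` A)"
    unfolding u monom_add by (intro ideal.span_scale ideal.span_base imageI)
qed

lemma minimal_monomial_generators_eq:
  fixes I :: "('n::finite, 'k::field) mpoly set"
  assumes "minimal_monomial_generators I A"
  shows "A = {u. monom u \<in> I \<and> (\<forall>v w. u = v + w \<longrightarrow> monom v \<in> I \<longrightarrow> w = 0)}" (is "A = ?M")
proof (intro set_eqI iffI)
  have I: "ideal.span (monom ` A) = I"
    and min: "\<And>B. B \<subset> A \<Longrightarrow> ideal.span (monom ` B) \<noteq> I"
    using assms by (auto simp: minimal_monomial_generators_def)
  have mem: "monom u \<in> I \<longleftrightarrow> (\<exists>a\<in>A. \<exists>w. u = a + w)" for u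
    unfolding I[symmetric] by (rule monom_in_span_iff)
  fix u
  show "u \<in> A" if "u \<in> ?M"
  proof -
    from that mem obtain a w where a: "a \<in> A" "u = a + w" by blast
    have "a = a + 0" by simp
    with a(1) have "monom a \<in> I" unfolding mem by blast
    with that a(2) have "w = 0" by blast
    with a show "u \<in> A" by simp
  qed
  assume u: "u \<in> A"
  have "w = 0" if "u = v + w" "monom v \<in> I" for v w
  proof (rule ccontr)
    assume "w \<noteq> 0"
    from that(2) mem obtain a w' where a: "a \<in> A" "v = a + w'" by auto
    have "a \<noteq> u"
    proof
      assume "a = u"
      then have "u + 0 = u + (w' + w)" using that(1) a(2) by (simp add: add.assoc)
      then have "w' + w = 0" by (metis add_left_cancel)
      then have "Poly_Mapping.lookup w' k + Poly_Mapping.lookup w k = 0" for k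
        by (metis lookup_add lookup_zero)
      then have "w = 0" by (intro poly_mapping_eqI) simp
      with \<open>w \<noteq> 0\<close> show False by simp
    qed
    have "ideal.span (monom ` (A - {u})) = I"
    proof (rule ideal.span_subspace)
      show "monom ` (A - {u}) \<subseteq> I" using I ideal.span_base by blast
      show "ideal.subspace I" using I ideal.subspace_span by metis
      have "(monom x :: ('n, 'k) mpoly) \<in> ideal.span (monom ` (A - {u}))" if "x \<in> A" for x
      proof (cases "x = u")
        case True
        have "x = a + (w' + w)" using True \<open>u = v + w\<close> a(2) by (simp add: add.assoc)
        then show ?thesis using a(1) \<open>a \<noteq> u\<close> unfolding monom_in_span_iff by blast
      next
        case False
        with that show ?thesis by (intro ideal.span_base imageI) simp
      qed
      then show "I \<subseteq> ideal.span (monom ` (A - {u}))"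
        unfolding I[symmetric] by (intro ideal.span_minimal ideal.subspace_span) auto
    qed
    with min[of "A - {u}"] u show False by blast
  qed
  moreover have "monom u \<in> I"
    unfolding mem using u by (intro bexI[of _ u] exI[of _ 0]) simp_all
  ultimately show "u \<in> ?M" by blast
qed

lemma ex1_minimal_monomial_generators:
  fixes I :: "('n::finite, 'k::field) mpoly set"
  assumes "monomial_ideal I"
  shows "\<exists>!A. minimal_monomial_generators I A"
proof (rule ex_ex1I)
  show "A = B" if "minimal_monomial_generators I A" "minimal_monomial_generators I B" for A B
    using that[THEN minimal_monomial_generators_eq] by (rule trans[OF _ sym])
  from assms obtain A where I: "I = ideal.span (monom ` A)"
    by (auto simp: monomial_ideal_def)
  define M where "M = {a \<in> A. \<forall>b\<in>A. \<forall>w. a = b + w \<longrightarrow> w = 0}"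
  have deg_add: "deg (b + w) = deg b + deg w" for b w :: "'n exponent"
    by (simp add: deg_def deg_in_def lookup_add sum.distrib)
  have deg_0: "w = 0" if "deg w = 0" for w :: "'n exponent"
    using that by (intro poly_mapping_eqI) (simp add: deg_def deg_in_def)
  have below: "\<exists>b\<in>M. \<exists>w. a = b + w" if "a \<in> A" for a
    using that
  proof (induction "deg a" arbitrary: a rule: less_induct)
    case less
    show ?case
    proof (cases "a \<in> M")
      case True
      then show ?thesis by (intro bexI[of _ a] exI[of _ 0]) simp_all
    next
      case False
      with less.prems obtain b w where b: "b \<in> A" "a = b + w" "w \<noteq> 0"
        by (auto simp: M_def)
      then have "deg b < deg a" using deg_add deg_0 by fastforce
      from less.hyps[OF this b(1)] obtain c w' where c: "c \<in> M" "b = c + w'" by blast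
      then have "a = c + (w' + w)" using b(2) by (simp add: add.assoc)
      with c(1) show ?thesis by blast
    qed
  qed
  have "ideal.span (monom ` M) = I"
  proof (rule ideal.span_subspace)
    show "monom ` M \<subseteq> I" unfolding I M_def by (auto intro: ideal.span_base)
    show "ideal.subspace I" unfolding I by (rule ideal.subspace_span)
    show "I \<subseteq> ideal.span (monom ` M)"
      unfolding I using below
      by (intro ideal.span_minimal ideal.subspace_span) (auto simp: monom_in_span_iff)
  qed
  moreover have "ideal.span (monom ` B) \<noteq> I" if "B \<subset> M" for B
  proof
    assume B: "ideal.span (monom ` B) = I"
    from that obtain u where u: "u \<in> M" "u \<notin> B" by blast
    then have "(monom u :: ('n, 'k) mpoly) \<in> ideal.span (monom ` B)"
      unfolding B I M_def by (auto intro: ideal.span_base)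
    then obtain b w where b: "b \<in> B" "u = b + w" unfolding monom_in_span_iff by blast
    then have "w = 0" using u that unfolding M_def by blast
    with b u show False by simp
  qed
  ultimately show "\<exists>A. minimal_monomial_generators I A"
    unfolding minimal_monomial_generators_def by blast
qed

end

theory Submission
  imports Defs
begin

text \<open>
  Everything is read off from exponent vectors. The power \<open>\<mm>\<^sub>J\<^sup>a\<close> consists of the polynomials all of
  whose monomials have degree at least \<open>a\<close> in the variables indexed by \<open>J\<close>
  (\<open>ideal_power_var_ideal\<close>), so \<open>I\<close> is spanned by the monomials \<open>u\<close> with
  \<open>deg_on J u \<ge> a\<close> for each of the four sets \<open>J\<close>. A monomial of \<open>I\<close> is a minimal generator only if
  each of its variables lies in a set \<open>J\<close> that is \<^emph>\<open>tight\<close>, meaning \<open>deg_on J u = a\<close>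
  (\<open>ex_tight\<close>). Replacing \<open>v\<close> by \<open>x\<^sub>i (v / x\<^sub>j)\<close> stays inside \<open>I\<close> as soon as each set that contains
  \<open>j\<close> either contains \<open>i\<close> or is not tight for \<open>v\<close> (\<open>exchange_in_covers\<close>).

  The hypotheses on the four sets say that they form a path: with the five disjoint blocks
  \<open>J\<^sub>1 - J\<^sub>2\<close>, \<open>J\<^sub>1 \<inter> J\<^sub>2\<close>, \<open>J\<^sub>2 \<inter> J\<^sub>3\<close>, \<open>J\<^sub>3 \<inter> J\<^sub>4\<close>, \<open>J\<^sub>4 - J\<^sub>3\<close>, each \<open>J\<^sub>k\<close> is the union of the
  \<open>k\<close>-th and the next block. The two outer sets \<open>J\<^sub>1\<close> and \<open>J\<^sub>4\<close> turn out to be tight for every minimal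
  generator \<open>u\<close> (\<open>end_tight\<close>), whence \<open>deg u = 2a + deg_on (J\<^sub>2 \<inter> J\<^sub>3) u\<close> (\<open>deg_path\<close>): comparing total
  degrees of generators is comparing their degrees in the middle block.

  Now let \<open>deg u \<le> deg v\<close> and let \<open>u\<close> have the larger exponent at \<open>i\<close>. If \<open>i\<close> is in the middle block,
  then \<open>v\<close> has at least the degree of \<open>u\<close> there, hence a larger exponent at some other \<open>j\<close> of the same
  block, which can be exchanged. If \<open>i \<in> J\<^sub>1\<close>, then \<open>u\<close> and \<open>v\<close> both have degree \<open>a\<close> on
  \<open>J\<^sub>1\<close>, which gives a \<open>j \<in> J\<^sub>1\<close>. The only obstacle is that \<open>j \<in> J\<^sub>2\<close>, \<open>i \<notin> J\<^sub>2\<close> and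
  \<open>J\<^sub>2\<close> is tight for \<open>v\<close>; but when \<open>J\<^sub>2\<close> is tight, the comparison on the middle block shows
  that \<open>j\<close> can be found in \<open>J\<^sub>1 - J\<^sub>2\<close> (\<open>exchange_at_end\<close>). The case
  \<open>i \<in> J\<^sub>4\<close> follows by reversing the path.
\<close>

section \<open>Degrees on a set of variables\<close>

definition deg_on :: "'n set \<Rightarrow> 'n::finite exponent \<Rightarrow> nat" where
  "deg_on J u = (\<Sum>i\<in>J. deg_in i u)"

lemma deg_in_add: "deg_in i (u + w) = deg_in i u + deg_in i w"
  by (simp add: deg_in_def lookup_add)

lemma deg_on_add: "deg_on J (u + w) = deg_on J u + deg_on J w"
  by (simp add: deg_on_def deg_in_add sum.distrib)

lemma deg_on_single: "deg_on J (Poly_Mapping.single i 1) = (if i \<in> J then 1 else 0)"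
  by (simp add: deg_on_def deg_in_def lookup_single when_def)

lemma deg_on_Un:
  "A \<inter> B = {} \<Longrightarrow> deg_on (A \<union> B) u = deg_on A u + deg_on B u"
  unfolding deg_on_def by (rule sum.union_disjoint) simp_all

lemma deg_on_split: "deg_on J u = deg_on (J - B) u + deg_on (J \<inter> B) u"
  unfolding deg_on_def by (subst add.commute) (rule sum.Int_Diff, simp)

lemma minus_single_add:
  assumes "deg_in i u > 0"
  shows "u = Poly_Mapping.single i 1 + (u - Poly_Mapping.single i 1)"
  using assms
  by (intro poly_mapping_eqI) (auto simp: deg_in_def lookup_add lookup_minus lookup_single when_def)

lemma ex_deg_in_less:
  assumes "deg_on A u \<le> deg_on A v" "i \<in> A" "deg_in i v < deg_in i u"
  shows "\<exists>j\<in>A. deg_in j v > deg_in j u"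
proof (rule ccontr)
  assume "\<not> ?thesis"
  then have "\<forall>j\<in>A. deg_in j v \<le> deg_in j u" by auto
  with assms(2,3) have "deg_on A v < deg_on A u"
    unfolding deg_on_def by (intro sum_strict_mono_ex1) auto
  with assms(1) show False by simp
qed

section \<open>Intersections of powers of monomial primes\<close>

text \<open>
  Membership in a monomial ideal can be tested on each monomial separately.
\<close>

lemma span_monom_upclosed:
  fixes U :: "'n exponent set"
  assumes "\<And>u w. u \<in> U \<Longrightarrow> u + w \<in> U"
  shows "ideal.span (monom ` U) = {p :: ('n, 'k::field) mpoly. Poly_Mapping.keys p \<subseteq> U}"
    (is "_ = ?T")
proof (rule ideal.span_subspace)
  show "monom ` U \<subseteq> ?T" by (auto simp: monom_def)
  show "ideal.subspace ?T"
  proof (rule ideal.subspaceI)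
    fix p q :: "('n, 'k) mpoly" assume "p \<in> ?T" "q \<in> ?T"
    then show "p + q \<in> ?T" using Poly_Mapping.keys_add[of p q] by blast
  next
    fix c p :: "('n, 'k) mpoly" assume p: "p \<in> ?T"
    have "k \<in> U" if "k \<in> Poly_Mapping.keys (c * p)" for k
    proof -
      from that obtain x y where "k = x + y" "y \<in> Poly_Mapping.keys p"
        using keys_mult[of c p] by blast
      with p assms[of y x] show ?thesis by (auto simp: add.commute)
    qed
    then show "c * p \<in> ?T" by blast
  qed simp
  show "?T \<subseteq> ideal.span (monom ` U)"
  proof
    fix p :: "('n, 'k) mpoly" assume p: "p \<in> ?T"
    have "p = (\<Sum>k\<in>Poly_Mapping.keys p. Poly_Mapping.single k (Poly_Mapping.lookup p k))"
      by (intro poly_mapping_eqI)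
        (auto simp: lookup_sum lookup_single when_def in_keys_iff)
    also have "\<dots> = (\<Sum>k\<in>Poly_Mapping.keys p.
        Poly_Mapping.single 0 (Poly_Mapping.lookup p k) * monom k)"
      by (simp add: monom_def mult_single)
    also have "\<dots> \<in> ideal.span (monom ` U)"
      using p by (intro ideal.span_sum ideal.span_scale ideal.span_base) auto
    finally show "p \<in> ideal.span (monom ` U)" .
  qed
qed

text \<open>
  Reading \<open>F\<close> as the edges of a hypergraph on the variables, these are its vertex covers of order
  \<open>a\<close>: multiplicities on the vertices that put total weight at least \<open>a\<close> on each edge.
\<close>

definition covers :: "'n set set \<Rightarrow> nat \<Rightarrow> 'n::finite exponent set" where
  "covers F a = {u. \<forall>J\<in>F. a \<le> deg_on J u}"

lemma covers_add: "u \<in> covers F a \<Longrightarrow> u + w \<in> covers F a"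
  by (auto simp: covers_def deg_on_add intro: le_trans)

lemma span_monom_covers:
  "ideal.span (monom ` covers F a) =
     {p :: ('n::finite, 'k::field) mpoly. Poly_Mapping.keys p \<subseteq> covers F a}"
  by (rule span_monom_upclosed) (rule covers_add)

text \<open>
  As long as the degree on \<open>J\<close> is positive, a variable indexed by \<open>J\<close> can be split off, and this
  lowers the degree on \<open>J\<close> by exactly one.
\<close>

lemma monom_in_power:
  assumes "a \<le> deg_on J u"
  shows "(monom u :: ('n::finite, 'k::field) mpoly) \<in> ideal_power (var_ideal J) a"
  using assms
proof (induction a arbitrary: u)
  case (Suc a)
  then have "deg_on J u \<noteq> 0" by simp
  then obtain i where i: "i \<in> J" "deg_in i u > 0"
    unfolding deg_on_def by (meson gr0I sum.neutral)
  define w where "w = u - Poly_Mapping.single i 1"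
  have u: "u = Poly_Mapping.single i 1 + w"
    unfolding w_def by (rule minus_single_add) fact
  have "a \<le> deg_on J w"
    using Suc.prems i(1) unfolding u deg_on_add deg_on_single by simp
  then have "(monom w :: ('n, 'k) mpoly) \<in> ideal_power (var_ideal J) a" by (rule Suc.IH)
  moreover have "(var i :: ('n, 'k) mpoly) \<in> var_ideal J"
    unfolding var_ideal_def using i(1) by (intro ideal.span_base imageI)
  ultimately show ?case
    unfolding u monom_add ideal_power.simps ideal_mult_def var_def
    by (intro ideal.span_base) blast
qed simp

lemma ideal_power_var_ideal:
  "ideal_power (var_ideal J) a =
     {p :: ('n::finite, 'k::field) mpoly. Poly_Mapping.keys p \<subseteq> covers {J} a}"
proof
  show "{p :: ('n, 'k) mpoly. Poly_Mapping.keys p \<subseteq> covers {J} a} \<subseteq> ideal_power (var_ideal J) a"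
  proof -
    have "ideal.subspace (ideal_power (var_ideal J :: ('n, 'k) mpoly set) a)"
      by (cases a) (simp_all add: ideal_mult_def ideal.subspace_UNIV)
    then have "ideal.span (monom ` covers {J} a) \<subseteq> ideal_power (var_ideal J :: ('n, 'k) mpoly set) a"
      by (intro ideal.span_minimal) (auto simp: covers_def intro: monom_in_power)
    then show ?thesis by (simp only: span_monom_covers)
  qed
  show "ideal_power (var_ideal J) a \<subseteq> {p :: ('n, 'k) mpoly. Poly_Mapping.keys p \<subseteq> covers {J} a}"
  proof (induction a)
    case 0
    show ?case by (simp add: covers_def)
  next
    case (Suc a)
    have sub: "ideal.subspace {p :: ('n, 'k) mpoly. Poly_Mapping.keys p \<subseteq> covers {J} b}" for b
      unfolding span_monom_covers[symmetric] by (rule ideal.subspace_span)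
    have var: "var_ideal J \<subseteq> {p :: ('n, 'k) mpoly. Poly_Mapping.keys p \<subseteq> covers {J} 1}"
      unfolding var_ideal_def
      by (intro ideal.span_minimal sub)
        (use deg_on_single[of J] in \<open>auto simp: var_def monom_def covers_def\<close>)
    have keys: "x + y \<in> covers {J} (Suc a)"
      if "p \<in> var_ideal J" "q \<in> ideal_power (var_ideal J) a"
        "x \<in> Poly_Mapping.keys p" "y \<in> Poly_Mapping.keys q" for p q :: "('n, 'k) mpoly" and x y
    proof -
      have "x \<in> covers {J} 1" "y \<in> covers {J} a"
        using that Suc.IH var by blast+
      then show ?thesis by (simp add: covers_def deg_on_add)
    qed
    have "Poly_Mapping.keys (p * q) \<subseteq> covers {J} (Suc a)"
      if "p \<in> var_ideal J" "q \<in> ideal_power (var_ideal J) a" for p q :: "('n, 'k) mpoly"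
      using keys[OF that] keys_mult[of p q] by blast
    then show ?case
      unfolding ideal_power.simps ideal_mult_def
      by (intro ideal.span_minimal sub) auto
  qed
qed

lemma monom_in_span_covers_iff:
  "(monom u :: ('n::finite, 'k::field) mpoly) \<in> ideal.span (monom ` covers F a) \<longleftrightarrow> u \<in> covers F a"
  unfolding span_monom_covers by (simp add: monom_def)

lemma G_span_covers:
  "G (ideal.span (monom ` covers F a) :: ('n::finite, 'k::field) mpoly set) =
     {u \<in> covers F a. \<forall>v w. u = v + w \<longrightarrow> v \<in> covers F a \<longrightarrow> w = 0}"
proof -
  let ?I = "ideal.span (monom ` covers F a) :: ('n, 'k) mpoly set"
  have "monomial_ideal ?I" by (auto simp: monomial_ideal_def)
  then have "minimal_monomial_generators ?I (G ?I)"
    unfolding G_def by (rule theI'[OF ex1_minimal_monomial_generators])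
  from minimal_monomial_generators_eq[OF this] show ?thesis
    by (simp add: monom_in_span_covers_iff)
qed

lemma G_span_covers_D:
  "u \<in> G (ideal.span (monom ` covers F a) :: ('n::finite, 'k::field) mpoly set) \<Longrightarrow> u \<in> covers F a"
  by (simp add: G_span_covers)

section \<open>Tight sets and exchanges\<close>

text \<open>
  If no set containing \<open>i\<close> were tight, the variable \<open>x\<^sub>i\<close> could be divided out without leaving the
  ideal.
\<close>

lemma ex_tight:
  assumes u: "u \<in> G (ideal.span (monom ` covers F a) :: ('n::finite, 'k::field) mpoly set)"
    and i: "deg_in i u > 0"
  shows "\<exists>J\<in>F. i \<in> J \<and> deg_on J u = a"
proof -
  define w where "w = u - Poly_Mapping.single i 1"
  have eq: "u = w + Poly_Mapping.single i 1"
    unfolding w_def by (subst add.commute) (rule minus_single_add[OF i])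
  have "Poly_Mapping.single i (1::nat) \<noteq> 0" by (metis lookup_single_eq lookup_zero zero_neq_one)
  with u eq have "w \<notin> covers F a" unfolding G_span_covers by blast
  then obtain J where J: "J \<in> F" "deg_on J w < a" by (auto simp: covers_def not_le)
  moreover have "a \<le> deg_on J u" using G_span_covers_D[OF u] J(1) by (simp add: covers_def)
  moreover have "deg_on J u = deg_on J w + (if i \<in> J then 1 else 0)"
    by (subst eq) (simp only: deg_on_add deg_on_single)
  ultimately have "i \<in> J \<and> deg_on J u = a" by (simp split: if_splits)
  with J(1) show ?thesis by blast
qed

lemma exchange_in_covers:
  assumes v: "v \<in> covers F a" and j: "deg_in j v > 0"
    and F: "\<And>J. J \<in> F \<Longrightarrow> j \<in> J \<Longrightarrow> i \<in> J \<or> deg_on J v \<noteq> a"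
  shows "v - Poly_Mapping.single j 1 + Poly_Mapping.single i 1 \<in> covers F a"
proof -
  define w where "w = v - Poly_Mapping.single j 1"
  have eq: "v = Poly_Mapping.single j 1 + w"
    unfolding w_def by (rule minus_single_add[OF j])
  have "a \<le> deg_on J (w + Poly_Mapping.single i 1)" if "J \<in> F" for J
  proof -
    have "a \<le> deg_on J v" using v that by (simp add: covers_def)
    moreover have "deg_on J v = (if j \<in> J then 1 else 0) + deg_on J w"
      by (subst eq) (simp only: deg_on_add deg_on_single)
    ultimately show ?thesis using F[OF that]
      unfolding deg_on_add deg_on_single by (auto split: if_splits)
  qed
  then show ?thesis by (simp add: covers_def w_def)
qed

section \<open>Four sets along a path\<close>

text \<open>
  The conditions on the four sets are invariant under reversing their order; stated as one
  predicate, they let the case of \<open>J4\<close> be obtained from that of \<open>J1\<close>.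
\<close>

definition path4 :: "'n set \<Rightarrow> 'n set \<Rightarrow> 'n set \<Rightarrow> 'n set \<Rightarrow> bool" where
  "path4 J1 J2 J3 J4 \<longleftrightarrow>
     J1 \<inter> J3 = {} \<and> J1 \<inter> J4 = {} \<and> J2 \<inter> J4 = {} \<and> J2 \<subseteq> J1 \<union> J3 \<and> J3 \<subseteq> J2 \<union> J4"

lemma path4_rev: "path4 J1 J2 J3 J4 \<Longrightarrow> path4 J4 J3 J2 J1"
  unfolding path4_def by blast

lemma rev_family: "{J4, J3, J2, J1} = {J1, J2, J3, J4}"
  by blast

text \<open>
  A variable of \<open>u\<close> in \<open>J1 - J2\<close> lies in no other set, which forces \<open>J1\<close> to be tight. Without such a
  variable the whole degree on \<open>J1\<close> comes from \<open>J1 \<inter> J2\<close>, so it is also bounded by the degree on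
  \<open>J2\<close>, and one of the two sets is tight.
\<close>

lemma end_tight:
  assumes path: "path4 J1 J2 J3 J4"
    and u: "u \<in> G (ideal.span (monom ` covers {J1, J2, J3, J4} a) :: ('n::finite, 'k::field) mpoly set)"
  shows "deg_on J1 u = a"
proof (rule antisym)
  show "a \<le> deg_on J1 u" using G_span_covers_D[OF u] by (simp add: covers_def)
  show "deg_on J1 u \<le> a"
  proof (cases "\<exists>i\<in>J1 - J2. deg_in i u > 0")
    case True
    then obtain i where "i \<in> J1 - J2" "deg_in i u > 0" by blast
    with ex_tight[OF u, of i] path show ?thesis by (auto simp: path4_def)
  next
    case False
    then have "deg_on (J1 - J2) u = 0" by (simp add: deg_on_def)
    then have le: "deg_on J1 u = deg_on (J1 \<inter> J2) u" by (simp add: deg_on_split[of J1 u J2])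
    show ?thesis
    proof (cases "deg_on (J1 \<inter> J2) u = 0")
      case False
      then obtain i where "i \<in> J1 \<inter> J2" "deg_in i u > 0"
        unfolding deg_on_def by (meson gr0I sum.neutral)
      with ex_tight[OF u, of i] path have "deg_on J1 u = a \<or> deg_on J2 u = a"
        by (auto simp: path4_def)
      moreover have "deg_on (J1 \<inter> J2) u \<le> deg_on J2 u"
        by (simp add: deg_on_split[of J2 u J1] Int_commute)
      ultimately show ?thesis using le by linarith
    qed (simp add: le)
  qed
qed

text \<open>
  The variables of a generator lie in \<open>J1\<close>, in \<open>J4\<close> or in \<open>J2 \<inter> J3\<close>, which are disjoint, and each of
  the two end sets contributes \<open>a\<close>.
\<close>

lemma deg_path:
  assumes path: "path4 J1 J2 J3 J4"
    and u: "u \<in> G (ideal.span (monom ` covers {J1, J2, J3, J4} a) :: ('n::finite, 'k::field) mpoly set)"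
  shows "deg u = 2 * a + deg_on (J2 \<inter> J3) u"
proof -
  have "deg u = deg_on (J1 \<union> J4 \<union> (J2 \<inter> J3)) u"
    unfolding deg_def deg_on_def
  proof (rule sum.mono_neutral_right)
    have "i \<in> J1 \<union> J4 \<union> (J2 \<inter> J3)" if "deg_in i u > 0" for i
      using ex_tight[OF u that] path by (auto simp: path4_def)
    then show "\<forall>i\<in>UNIV - (J1 \<union> J4 \<union> (J2 \<inter> J3)). deg_in i u = 0" by blast
  qed auto
  also have "\<dots> = deg_on J1 u + deg_on J4 u + deg_on (J2 \<inter> J3) u"
  proof -
    have "(J1 \<union> J4) \<inter> (J2 \<inter> J3) = {}" "J1 \<inter> J4 = {}"
      using path by (auto simp: path4_def)
    then show ?thesis by (simp add: deg_on_Un)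
  qed
  also have "deg_on J1 u = a" by (rule end_tight[OF path u])
  also have "deg_on J4 u = a"
    by (rule end_tight[OF path4_rev[OF path]]) (use u in \<open>simp only: rev_family[of J4 J3 J2 J1]\<close>)
  finally show ?thesis by simp
qed

text \<open>
  Within \<open>J1\<close> the degrees of \<open>u\<close> and \<open>v\<close> agree, so some \<open>j \<in> J1\<close> makes up for \<open>i\<close>; besides \<open>J1\<close>,
  only \<open>J2\<close> can contain \<open>j\<close>, so \<open>J2\<close> is the only set whose inequality the exchange could violate.
\<close>

lemma exchange_at_end:
  assumes path: "path4 J1 J2 J3 J4"
    and u: "u \<in> G (ideal.span (monom ` covers {J1, J2, J3, J4} a) :: ('n::finite, 'k::field) mpoly set)"
    and v: "v \<in> G (ideal.span (monom ` covers {J1, J2, J3, J4} a) :: ('n, 'k) mpoly set)"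
    and mid: "deg_on (J2 \<inter> J3) u \<le> deg_on (J2 \<inter> J3) v"
    and i: "i \<in> J1" "deg_in i v < deg_in i u"
  shows "\<exists>j. deg_in j v > deg_in j u \<and>
    v - Poly_Mapping.single j 1 + Poly_Mapping.single i 1 \<in> covers {J1, J2, J3, J4} a"
proof -
  have tight: "deg_on J1 u = a" "deg_on J1 v = a"
    using end_tight[OF path] u v by blast+
  have vc: "v \<in> covers {J1, J2, J3, J4} a" by (rule G_span_covers_D[OF v])
  have "\<exists>j\<in>J1. deg_in j v > deg_in j u \<and> (j \<in> J2 \<longrightarrow> i \<in> J2 \<or> deg_on J2 v \<noteq> a)"
  proof (cases "i \<in> J2 \<or> deg_on J2 v \<noteq> a")
    case True
    with ex_deg_in_less[of J1 u v i] tight i show ?thesis by auto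
  next
    case False
    \<comment> \<open>\<open>J2\<close> is tight for \<open>v\<close> but not necessarily for \<open>u\<close>, and \<open>v\<close> uses at least as much of it in
      the middle block as \<open>u\<close>; so \<open>v\<close> has at most the degree of \<open>u\<close> on \<open>J1 \<inter> J2\<close>, and therefore at
      least the degree of \<open>u\<close> on \<open>J1 - J2\<close>.\<close>
    have "J2 - J1 = J2 \<inter> J3" using path by (auto simp: path4_def)
    then have J2: "deg_on J2 w = deg_on (J2 \<inter> J3) w + deg_on (J1 \<inter> J2) w" for w
      using deg_on_split[of J2 w J1] by (simp add: Int_commute)
    have "a \<le> deg_on J2 u" using G_span_covers_D[OF u] by (simp add: covers_def)
    with J2[of u] J2[of v] mid False have "deg_on (J1 \<inter> J2) v \<le> deg_on (J1 \<inter> J2) u" by simp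
    with tight have "deg_on (J1 - J2) u \<le> deg_on (J1 - J2) v"
      using deg_on_split[of J1 u J2] deg_on_split[of J1 v J2] by simp
    with ex_deg_in_less[of "J1 - J2" u v i] i False show ?thesis by auto
  qed
  then obtain j where j: "j \<in> J1" "deg_in j v > deg_in j u"
    "j \<in> J2 \<longrightarrow> i \<in> J2 \<or> deg_on J2 v \<noteq> a" by blast
  from path j(1) have "j \<notin> J3" "j \<notin> J4" by (auto simp: path4_def)
  with i(1) j vc
  have "v - Poly_Mapping.single j 1 + Poly_Mapping.single i 1 \<in> covers {J1, J2, J3, J4} a"
    by (intro exchange_in_covers) auto
  with j(2) show ?thesis by blast
qed

theorem theorem2p8:
  fixes J1 J2 J3 J4 :: "'n::finite set"
    and a :: nat
    and I :: "('n, 'k::field) mpoly set"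
  assumes "J1 \<inter> J3 = {}" and "J1 \<inter> J4 = {}" and "J2 \<inter> J4 = {}"
    and "J2 \<subseteq> J1 \<union> J3" and "J3 \<subseteq> J2 \<union> J4"
    and "a > 0"
    and "I = ideal_power (var_ideal J1) a \<inter> ideal_power (var_ideal J2) a
           \<inter> ideal_power (var_ideal J3) a \<inter> ideal_power (var_ideal J4) a"
  shows "nonpure_dual_exchange I"
proof -
  let ?F = "{J1, J2, J3, J4}"
  have path: "path4 J1 J2 J3 J4" using assms(1-5) by (simp add: path4_def)
  have I: "I = ideal.span (monom ` covers ?F a)"
    unfolding assms(7) ideal_power_var_ideal span_monom_covers by (auto simp: covers_def)
  have exchange: "\<exists>j. deg_in j v > deg_in j u \<and>
      v - Poly_Mapping.single j 1 + Poly_Mapping.single i 1 \<in> covers ?F a"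
    if u: "u \<in> G I" and v: "v \<in> G I" and le: "deg u \<le> deg v" and i: "deg_in i v < deg_in i u"
    for u v i
  proof -
    note uv = u[unfolded I] v[unfolded I]
    have mid: "deg_on (J2 \<inter> J3) u \<le> deg_on (J2 \<inter> J3) v"
      using le uv[THEN deg_path[OF path]] by simp
    have "deg_in i u > 0" using i by simp
    with ex_tight[OF uv(1)] path consider "i \<in> J1" | "i \<in> J4" | "i \<in> J2 \<inter> J3"
      unfolding path4_def by blast
    then show ?thesis
    proof cases
      case 1
      then show ?thesis using exchange_at_end[OF path uv mid _ i] by blast
    next
      case 2
      then show ?thesis
        using exchange_at_end[OF path4_rev[OF path], unfolded rev_family[of J4 J3 J2 J1], OF uv _ _ i] mid
        by (simp add: Int_commute)
    next
      case 3
      from ex_deg_in_less[OF mid this i]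
      obtain j where j: "j \<in> J2 \<inter> J3" "deg_in j v > deg_in j u" by blast
      \<comment> \<open>The sets containing \<open>j\<close> are \<open>J2\<close> and \<open>J3\<close>, and both contain \<open>i\<close>.\<close>
      from path j(1) have "j \<notin> J1" "j \<notin> J4" by (auto simp: path4_def)
      moreover have "v \<in> covers ?F a" by (rule G_span_covers_D[OF uv(2)])
      ultimately have "v - Poly_Mapping.single j 1 + Poly_Mapping.single i 1 \<in> covers ?F a"
        using j 3 by (intro exchange_in_covers) auto
      with j(2) show ?thesis by blast
    qed
  qed
  have "monomial_ideal I" unfolding monomial_ideal_def I by blast
  moreover have "(monom w :: ('n, 'k) mpoly) \<in> I \<longleftrightarrow> w \<in> covers ?F a" for w
    unfolding I by (rule monom_in_span_covers_iff)
  ultimately show ?thesis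
    unfolding nonpure_dual_exchange_def using exchange by simp
qed

end
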